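(* Let $N,M\ge 1$ be integers and let $0=v_0<v_1<\cdots<v_{M-1}<v_M=1$. Under the condition $\bar f\in\Delta_M^N$, the system matrix $A(U)$ (defined in the context) is diagonalizable, and therefore the system $\partial_t U+A(U)\partial_x U=\frac1\epsilon\bar J_R(U)$ is hyperbolic.
   Context: The discrete-velocity traffic model with $N$ vehicle classes and $M+1$ velocities $v_0,\dots,v_M$ is the quasilinear system $\partial_t U+A(U)\partial_x U=\frac1\epsilon \bar J_R(U)$, where $\epsilon>0$ is a scaling parameter, $U=(U^1,\dots,U^N)^T$, $U^c=(\bar f^c_0,\dots,\bar f^c_M)^T$, and $\bar f_i^c=f_i^1+\cdots+f_i^c$ is the cumulative distribution of the first $c$ vehicle classes at velocity $v_i$ ($f_i^k$ being the distribution function of class $k$ at velocity $v_i$). Write $\bar f=(\bar f^1,\dots,\bar f^N)$ with $\bar f^c=(\bar f_0^c,\dots,\bar f_M^c)$. The total density is $r=\sum_{\ell=0}^M\bar f_\ell^N$. The source $\bar J_R(U)$ is a relaxation term with components $\bar J_R^{c,i}=\sum_{k=1}^c\frac{1}{T^k}\big(f_i^{e,k}(\rho)-f_i^k\big)$, where $T^k$ are relaxation times and $f_i^{e,k}(\rho)$ are equilibrium functions of the class densities $\rho=(\rho^1,\dots,\rho^N)$, $\rho^k=\sum_{i=0}^M f_i^k=\sum_{i=0}^M f_i^{e,k}(\rho)$; it plays no role for hyperbolicity. Hyperbolic means that $A(U)$ has real eigenvalues and a complete set of eigenvectors. The matrix $A(U)$ is the $N\times N$ block matrix with blocks of size $(M+1)\times(M+1)$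 given by $$A(U)=\begin{pmatrix} V&0&\cdots&0&A^1\\ 0&V&\cdots&0&A^2\\ \vdots&\vdots&\ddots&\vdots&\vdots\\ 0&0&\cdots&V&A^{N-1}\\ 0&0&\cdots&0&A^N+V\end{pmatrix},\qquad V=\operatorname{diag}(v_0,\dots,v_M),$$ where $A^c=(a^c_{i,j})_{i,j=0}^M$ has entries $$a^c_{i,i}=-\frac{1}{1-r}\sum_{\ell=i+1}^M (v_\ell-v_i)\bar f^c_\ell,\qquad a^c_{i,j}=\frac{1}{1-r}(v_i-v_j)\bar f_i^c\ \text{ for } j<i,\qquad a^c_{i,j}=0\ \text{ for } j>i$$ (in particular $a^c_{M,M}=0$). The physical domain is $$\Delta_M^N=\Big\{\bar f=(\bar f^1,\dots,\bar f^N),\ \bar f^c=(\bar f_0^c,\dots,\bar f_M^c)\in\mathbb{R}^{M+1},\ c=1,\dots,N\ :\ 0\le \bar f_i^1\le\cdots\le \bar f_i^N,\ \bar\rho^c=\sum_{i=0}^M\bar f_i^c,\ \bar\rho^N=r\le 1\Big\},$$ the inequalities $0\le \bar f_i^1\le\cdots\le \bar f_i^N$ being required for all $i=0,\dots,M$. *)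

theory Defs
  imports Complex_Main "Jordan_Normal_Form.Char_Poly" "Jordan_Normal_Form.VS_Connect"
begin

section \<open>Diagonalizability and hyperbolicity\<close>

definition diagonalizable :: "'a::field mat \<Rightarrow> bool" where
  "diagonalizable A \<longleftrightarrow> (\<exists>D. diagonal_mat D \<and> similar_mat A D)"

text \<open>The eigenvalues of a real matrix are taken in the complex numbers, so that
  this is a genuine restriction.\<close>

definition real_eigenvalues :: "real mat \<Rightarrow> bool" where
  "real_eigenvalues A \<longleftrightarrow> (\<forall>z. eigenvalue (map_mat complex_of_real A) z \<longrightarrow> z \<in> \<real>)"

definition complete_eigenvectors :: "'a::field mat \<Rightarrow> bool" where
  "complete_eigenvectors A \<longleftrightarrow>
     (\<exists>B. vectorspace.basis class_ring (module_vec TYPE('a) (dim_row A)) B \<and>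
          (\<forall>b\<in>B. \<exists>k. eigenvector A b k))"

text \<open>A quasilinear system \<open>\<partial>\<^sub>t U + A(U) \<partial>\<^sub>x U = S(U)\<close> is given by its
  matrix \<open>A\<close> and its source \<open>S\<close>.\<close>

record quasilinear_system =
  qls_matrix :: "real vec \<Rightarrow> real mat"
  qls_source :: "real vec \<Rightarrow> real vec"

definition hyperbolic_at :: "('b) quasilinear_system_scheme \<Rightarrow> real vec \<Rightarrow> bool" where
  "hyperbolic_at S U \<longleftrightarrow> square_mat (qls_matrix S U) \<and>
     real_eigenvalues (qls_matrix S U) \<and> complete_eigenvectors (qls_matrix S U)"

section \<open>The discrete-velocity traffic model\<close>

text \<open>A state is the stacked vector \<open>U = (U\<^sup>1, \<dots>, U\<^sup>N)\<close> of length \<open>N (M + 1)\<close>.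
  Classes are numbered \<open>c = 1, \<dots>, N\<close>, velocities \<open>i = 0, \<dots>, M\<close>, whereas vector and
  matrix entries and blocks are indexed from 0: class \<open>c\<close> occupies block \<open>c - 1\<close>.\<close>

definition cumul :: "nat \<Rightarrow> real vec \<Rightarrow> nat \<Rightarrow> nat \<Rightarrow> real" where
  "cumul M U c i = U $ ((c - 1) * (M + 1) + i)"

definition cumul_density :: "nat \<Rightarrow> real vec \<Rightarrow> nat \<Rightarrow> real" where
  "cumul_density M U c = (\<Sum>i=0..M. cumul M U c i)"

definition total_density :: "nat \<Rightarrow> nat \<Rightarrow> real vec \<Rightarrow> real" where
  "total_density N M U = cumul_density M U N"

definition physical_domain :: "nat \<Rightarrow> nat \<Rightarrow> real vec set" where
  "physical_domain N M = {U \<in> carrier_vec (N * (M + 1)).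
     (\<forall>i\<le>M. 0 \<le> cumul M U 1 i \<and> (\<forall>c\<in>{1..<N}. cumul M U c i \<le> cumul M U (c + 1) i)) \<and>
     total_density N M U \<le> 1}"

definition velocity_matrix :: "nat \<Rightarrow> (nat \<Rightarrow> real) \<Rightarrow> real mat" where
  "velocity_matrix M v = mat_diag (M + 1) v"

text \<open>For \<open>r = 1\<close>, where the formula \<open>1 / (1 - r)\<close> is singular, this definition follows
  the convention \<open>x / 0 = 0\<close>; the matrix has its intended meaning for \<open>r < 1\<close>.\<close>

definition class_matrix ::
  "nat \<Rightarrow> nat \<Rightarrow> (nat \<Rightarrow> real) \<Rightarrow> real vec \<Rightarrow> nat \<Rightarrow> real mat" where
  "class_matrix N M v U c = mat (M + 1) (M + 1) (\<lambda>(i, j).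
     if j = i then
       - (1 / (1 - total_density N M U)) * (\<Sum>l=i+1..M. (v l - v i) * cumul M U c l)
     else if j < i then
       (1 / (1 - total_density N M U)) * (v i - v j) * cumul M U c i
     else 0)"

definition system_block ::
  "nat \<Rightarrow> nat \<Rightarrow> (nat \<Rightarrow> real) \<Rightarrow> real vec \<Rightarrow> nat \<Rightarrow> nat \<Rightarrow> real mat" where
  "system_block N M v U c d =
     (if c = N \<and> d = N then class_matrix N M v U N + velocity_matrix M v
      else if d = N then class_matrix N M v U c
      else if c = d then velocity_matrix M v
      else 0\<^sub>m (M + 1) (M + 1))"

definition system_matrix ::
  "nat \<Rightarrow> nat \<Rightarrow> (nat \<Rightarrow> real) \<Rightarrow> real vec \<Rightarrow> real mat" where
  "system_matrix N M v U = mat (N * (M + 1)) (N * (M + 1)) (\<lambda>(p, q).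
     system_block N M v U (p div (M + 1) + 1) (q div (M + 1) + 1)
       $$ (p mod (M + 1), q mod (M + 1)))"

definition class_distr :: "nat \<Rightarrow> real vec \<Rightarrow> nat \<Rightarrow> nat \<Rightarrow> real" where
  "class_distr M U k i =
     (if k = 1 then cumul M U 1 i else cumul M U k i - cumul M U (k - 1) i)"

definition class_density :: "nat \<Rightarrow> real vec \<Rightarrow> nat \<Rightarrow> real" where
  "class_density M U k = (\<Sum>i=0..M. class_distr M U k i)"

text \<open>Entry \<open>k - 1\<close> is the density \<open>\<rho>\<^sup>k\<close>.\<close>

definition density_vec :: "nat \<Rightarrow> nat \<Rightarrow> real vec \<Rightarrow> real vec" where
  "density_vec N M U = vec N (\<lambda>k. class_density M U (k + 1))"

text \<open>\<open>T k\<close> is the relaxation time of class \<open>k\<close>, and \<open>fe k i \<rho>\<close> its equilibrium function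
  at velocity \<open>v i\<close>.\<close>

definition relaxation_source ::
  "nat \<Rightarrow> nat \<Rightarrow> (nat \<Rightarrow> real) \<Rightarrow> (nat \<Rightarrow> nat \<Rightarrow> real vec \<Rightarrow> real) \<Rightarrow> real vec \<Rightarrow> real vec" where
  "relaxation_source N M T fe U = vec (N * (M + 1)) (\<lambda>p.
     \<Sum>k=1..p div (M + 1) + 1. (1 / T k) *
       (fe k (p mod (M + 1)) (density_vec N M U) - class_distr M U k (p mod (M + 1))))"

definition traffic_system ::
  "nat \<Rightarrow> nat \<Rightarrow> (nat \<Rightarrow> real) \<Rightarrow> real \<Rightarrow> (nat \<Rightarrow> real) \<Rightarrow>
   (nat \<Rightarrow> nat \<Rightarrow> real vec \<Rightarrow> real) \<Rightarrow> quasilinear_system" where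
  "traffic_system N M v \<epsilon> T fe =
     \<lparr> qls_matrix = system_matrix N M v,
       qls_source = (\<lambda>U. (1 / \<epsilon>) \<cdot>\<^sub>v relaxation_source N M T fe U) \<rparr>"

end

theory Submission
  imports Defs "Jordan_Normal_Form.DL_Rank"
begin

text \<open>With the last block moved to the front, \<open>A(U)\<close> is lower triangular, with the numbers
  \<open>\<lambda>\<^sub>i = v\<^sub>i - S\<^sub>i\<close> and the velocities on the diagonal, where
  \<open>S\<^sub>i = (1 / (1 - r)) \<Sum>\<^bsub>l > i\<^esub> (v\<^sub>l - v\<^sub>i) f\<^sub>l \<ge> 0\<close> for the last cumulative
  distribution \<open>f\<close>. Forward substitution yields an eigenvector for each diagonal entry unless
  two entries coincide and the right-hand side does not vanish. The \<open>\<lambda>\<^sub>i\<close> increase strictly,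
  so only \<open>\<lambda>\<^sub>j = v\<^sub>i\<close> has to be considered, and then \<open>i \<le> j\<close>. For \<open>i < j\<close> the
  right-hand side involves only entries of \<open>A\<^sup>c\<close> above its diagonal. For \<open>i = j\<close> it involves
  the diagonal entry \<open>a\<^sup>c\<^sub>i\<^sub>i\<close> too; but then \<open>S\<^sub>i = 0\<close>, and since the cumulative
  distributions increase with the class, \<open>a\<^sup>c\<^sub>i\<^sub>i\<close> vanishes as well.\<close>

section \<open>Diagonalizability, real eigenvalues and eigenbases\<close>

text \<open>A trivial kernel makes \<open>P\<close> invertible, so \<open>A * P = P * D\<close> can
  be solved for \<open>A\<close>.\<close>

lemma similar_mat_if_eigenbasis:
  fixes A D P :: "'a::field mat"
  assumes A: "A \<in> carrier_mat n n" and D: "D \<in> carrier_mat n n" and P: "P \<in> carrier_mat n n"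
    and AP: "A * P = P * D"
    and ker: "\<And>z. z \<in> carrier_vec n \<Longrightarrow> P *\<^sub>v z = 0\<^sub>v n \<Longrightarrow> z = 0\<^sub>v n"
  shows "similar_mat A D"
proof -
  have "det P \<noteq> 0"
    using det_0_iff_vec_prod_zero_field[OF P] ker by blast
  then obtain Q where Q: "Q \<in> carrier_mat n n" and QP: "Q * P = 1\<^sub>m n" and PQ: "P * Q = 1\<^sub>m n"
    using det_non_zero_imp_unit[OF P, where b = "()"]
    by (auto simp: Units_def ring_mat_def)
  have "P * D * Q = A * P * Q"
    by (simp add: AP)
  also have "\<dots> = A"
    using A P Q by (simp add: assoc_mult_mat[of _ n n _ n _ n] PQ)
  finally show ?thesis
    using A D P Q PQ QP by (intro similar_matI[of _ _ P Q n]) auto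
qed

text \<open>Similarity preserves the characteristic polynomial, so that of \<open>A\<close> splits
  into real linear factors, and passing to complex coefficients adds no roots.\<close>

lemma diagonalizable_imp_real_eigenvalues:
  fixes A :: "real mat"
  assumes "diagonalizable A"
  shows "real_eigenvalues A"
  unfolding real_eigenvalues_def
proof (intro allI impI)
  fix z
  assume ev: "eigenvalue (map_mat complex_of_real A) z"
  obtain D where D: "diagonal_mat D" and sim: "similar_mat A D"
    using assms unfolding diagonalizable_def by blast
  obtain n where A: "A \<in> carrier_mat n n" and Dc: "D \<in> carrier_mat n n"
    using similar_matD[OF sim] by auto
  have "upper_triangular D"
    using D Dc unfolding diagonal_mat_def by auto
  then have cp: "char_poly A = (\<Prod>a\<leftarrow>diag_mat D. [:- a, 1:])"
    using char_poly_similar[OF sim] char_poly_upper_triangular[OF Dc] by simp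
  interpret poly_hom: map_poly_comm_ring_hom complex_of_real ..
  have hom_lin: "map_poly complex_of_real (\<Prod>a\<leftarrow>as. [:- a, 1:])
      = (\<Prod>a\<leftarrow>as. [:- complex_of_real a, 1:])" for as
    by (induction as) (simp_all add: hom_distribs poly_hom.hom_mult del: mult_pCons_left)
  have "0 = poly (map_poly complex_of_real (char_poly A)) z"
    using ev A eigenvalue_root_char_poly[of "map_mat complex_of_real A" n]
    by (simp add: of_real_hom.char_poly_hom[OF A])
  also have "map_poly complex_of_real (char_poly A)
      = (\<Prod>a\<leftarrow>diag_mat D. [:- complex_of_real a, 1:])"
    unfolding cp by (rule hom_lin)
  finally have "(\<Prod>a\<leftarrow>diag_mat D. z - complex_of_real a) = 0"
    by (simp add: poly_prod_list o_def)
  then obtain a where "z = complex_of_real a"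
    by (auto simp: prod_list_zero_iff)
  then show "z \<in> \<real>"
    by simp
qed

text \<open>The columns of the transforming matrix \<open>P\<close> serve as the eigenbasis.\<close>

lemma diagonalizable_imp_complete_eigenvectors:
  fixes A :: "'a::field mat"
  assumes "diagonalizable A"
  shows "complete_eigenvectors A"
proof -
  obtain D where D: "diagonal_mat D" and sim: "similar_mat A D"
    using assms unfolding diagonalizable_def by blast
  obtain n P Q where carr: "{A, D, P, Q} \<subseteq> carrier_mat n n"
    and PQ: "P * Q = 1\<^sub>m n" and QP: "Q * P = 1\<^sub>m n" and A_eq: "A = P * D * Q"
    using similar_matD[OF sim] by blast
  then have A: "A \<in> carrier_mat n n" and Dc: "D \<in> carrier_mat n n"
    and P: "P \<in> carrier_mat n n" and Q: "Q \<in> carrier_mat n n"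
    by auto
  interpret vec_space "TYPE('a)" n .
  have detP: "det P \<noteq> 0"
    using arg_cong[OF QP, of det, unfolded det_mult[OF Q P] det_one] by auto
  \<comment> \<open>Distinctness ensures that the set of columns has \<open>n\<close> elements, the
    dimension of the space.\<close>
  have dist: "distinct (cols P)"
    using detP det_identical_cols[OF P] P by (auto simp: distinct_conv_nth)
  have indpt: "lin_indpt (set (cols P))"
    using lin_dep_cols_imp_det_0[OF P] detP by blast
  have basis: "basis (set (cols P))"
    using dist indpt P cols_dim[of P]
    by (intro dim_li_is_basis) (auto simp: distinct_card dim_is_n)
  have AP: "A * P = P * D"
    unfolding A_eq using Dc P Q QP by (simp add: assoc_mult_mat[of _ n n _ n _ n])
  have "eigenvector A (col P i) (D $$ (i, i))" if i: "i < n" for i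
  proof -
    have "col P i \<noteq> 0\<^sub>v n"
    proof
      assume "col P i = 0\<^sub>v n"
      then have "Q *\<^sub>v col P i = 0\<^sub>v n"
        using Q by auto
      moreover have "Q *\<^sub>v col P i = col (1\<^sub>m n) i"
        using i by (simp add: QP[symmetric] col_mult2[OF Q P])
      ultimately have "(0\<^sub>v n :: 'a vec) $ i = unit_vec n i $ i"
        using i by simp
      then show False
        using i by simp
    qed
    moreover have "A *\<^sub>v col P i = D $$ (i, i) \<cdot>\<^sub>v col P i"
    proof -
      have "col D i = D $$ (i, i) \<cdot>\<^sub>v unit_vec n i"
        using D Dc i by (intro eq_vecI) (auto simp: diagonal_mat_def)
      moreover have "P *\<^sub>v unit_vec n i = col P i"
        using P i by (intro eq_vecI) (auto simp: scalar_prod_right_unit)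
      ultimately have "col (P * D) i = D $$ (i, i) \<cdot>\<^sub>v col P i"
        using P i by (simp add: col_mult2[OF P Dc] mult_mat_vec[OF P])
      then show ?thesis
        using i by (simp add: AP[symmetric] col_mult2[OF A P])
    qed
    ultimately show ?thesis
      using A P i by (auto simp: eigenvector_def)
  qed
  then have "\<forall>b\<in>set (cols P). \<exists>k. eigenvector A b k"
    using P by (auto simp: cols_def intro!: exI)
  then show ?thesis
    unfolding complete_eigenvectors_def using basis A by auto
qed

section \<open>Triangular matrices with respect to a ranking\<close>

text \<open>Forward substitution for the eigenvalue \<open>A $$ (q, q)\<close> of a matrix that is triangular with
  respect to the ranking \<open>h\<close>. Where the divisor vanishes, \<open>x / 0 = 0\<close> makes the entry 0, which
  still solves the eigenvalue equation if the numerator vanishes as well.\<close>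

function ranked_eigenvector :: "'a::field mat \<Rightarrow> (nat \<Rightarrow> nat) \<Rightarrow> nat \<Rightarrow> nat \<Rightarrow> 'a" where
  "ranked_eigenvector A h q p = (if p = q then 1 else
     (\<Sum>r\<in>{r. r < dim_row A \<and> h r < h p}. A $$ (p, r) * ranked_eigenvector A h q r)
       / (A $$ (q, q) - A $$ (p, p)))"
  by auto
termination
  by (relation "measure (\<lambda>(A, h, q, p). h p)") auto

declare ranked_eigenvector.simps [simp del]

lemma ranked_eigenvector_self: "ranked_eigenvector A h q q = 1"
  by (simp add: ranked_eigenvector.simps)

text \<open>The sum defining such an entry runs over ranks strictly below that of \<open>q\<close>,
  so it never reaches the initial value 1 at \<open>q\<close>.\<close>

lemma ranked_eigenvector_eq_0:
  assumes "p \<noteq> q" and "h p \<le> h q"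
  shows "ranked_eigenvector A h q p = 0"
  using assms
proof (induction "h p" arbitrary: p rule: less_induct)
  case less
  have "(\<Sum>r\<in>{r. r < dim_row A \<and> h r < h p}. A $$ (p, r) * ranked_eigenvector A h q r) = 0"
    using less by (intro sum.neutral) force
  then show ?case
    using less.prems by (subst ranked_eigenvector.simps) simp
qed

text \<open>If the divisor is nonzero, the recursion is the eigenvalue equation of row
  \<open>p\<close> solved for its entry. Otherwise the sum over smaller ranks must vanish, which
  \<open>res\<close> guarantees for ranks from \<open>h q\<close> on and
  \<open>ranked_eigenvector_eq_0\<close> below.\<close>

lemma ranked_eigenvector_equation:
  fixes A :: "'a::field mat"
  assumes A: "A \<in> carrier_mat n n" and p: "p < n" and q: "q < n"
    and tri: "\<And>p q. p < n \<Longrightarrow> q < n \<Longrightarrow> p \<noteq> q \<Longrightarrow> h p \<le> h q \<Longrightarrow> A $$ (p, q) = 0"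
    and res: "\<And>p q r. p < n \<Longrightarrow> q < n \<Longrightarrow> r < n \<Longrightarrow> A $$ (p, p) = A $$ (q, q) \<Longrightarrow>
      h q \<le> h r \<Longrightarrow> h r < h p \<Longrightarrow> A $$ (p, r) = 0"
  shows "(\<Sum>r<n. A $$ (p, r) * ranked_eigenvector A h q r)
    = A $$ (q, q) * ranked_eigenvector A h q p"
proof -
  let ?u = "ranked_eigenvector A h q"
  let ?S = "\<Sum>r\<in>{r. r < n \<and> h r < h p}. A $$ (p, r) * ?u r"
  have "(\<Sum>r<n. A $$ (p, r) * ?u r) = (\<Sum>r\<in>insert p {r. r < n \<and> h r < h p}. A $$ (p, r) * ?u r)"
    using p tri[OF p] by (intro sum.mono_neutral_right) (auto simp: not_less[symmetric])
  then have split: "(\<Sum>r<n. A $$ (p, r) * ?u r) = A $$ (p, p) * ?u p + ?S"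
    by simp
  have vanish: "?S = 0" if "A $$ (p, p) = A $$ (q, q)"
  proof (rule sum.neutral, rule ballI)
    fix r
    assume "r \<in> {r. r < n \<and> h r < h p}"
    then show "A $$ (p, r) * ?u r = 0"
      using res[OF p q _ that] ranked_eigenvector_eq_0[of r q h A] by (cases "h q \<le> h r") auto
  qed
  show ?thesis
  proof (cases "A $$ (p, p) = A $$ (q, q)")
    case True
    then show ?thesis
      using split vanish by simp
  next
    case False
    then have "p \<noteq> q"
      by auto
    then have "?u p = ?S / (A $$ (q, q) - A $$ (p, p))"
      using A by (subst ranked_eigenvector.simps) auto
    with False have "?S = (A $$ (q, q) - A $$ (p, p)) * ?u p"
      by (simp add: field_simps)
    then show ?thesis
      using split by (simp add: algebra_simps)
  qed
qed

text \<open>Repeated diagonal entries are allowed: \<open>res\<close> removes the obstruction to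
  forward substitution. Indices may share a rank, since \<open>tri\<close> then makes the entries
  between them vanish.\<close>

lemma diagonalizable_if_ranked_triangular:
  fixes A :: "'a::field mat" and h :: "nat \<Rightarrow> nat"
  assumes A: "A \<in> carrier_mat n n"
    and tri: "\<And>p q. p < n \<Longrightarrow> q < n \<Longrightarrow> p \<noteq> q \<Longrightarrow> h p \<le> h q \<Longrightarrow> A $$ (p, q) = 0"
    and res: "\<And>p q r. p < n \<Longrightarrow> q < n \<Longrightarrow> r < n \<Longrightarrow> A $$ (p, p) = A $$ (q, q) \<Longrightarrow>
      h q \<le> h r \<Longrightarrow> h r < h p \<Longrightarrow> A $$ (p, r) = 0"
  shows "diagonalizable A"
proof -
  define P where "P = mat n n (\<lambda>(p, q). ranked_eigenvector A h q p)"
  define D where "D = mat_diag n (\<lambda>q. A $$ (q, q))"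
  have P: "P \<in> carrier_mat n n" and D: "D \<in> carrier_mat n n"
    by (auto simp: P_def D_def)
  have AP: "A * P = P * D"
  proof (rule eq_matI)
    fix p q
    assume "p < dim_row (P * D)" and "q < dim_col (P * D)"
    then have pq: "p < n" "q < n"
      using P D by auto
    have "(A * P) $$ (p, q) = (\<Sum>r<n. A $$ (p, r) * ranked_eigenvector A h q r)"
      using A P pq by (auto simp: P_def scalar_prod_def atLeast0LessThan intro!: sum.cong)
    also have "\<dots> = A $$ (q, q) * ranked_eigenvector A h q p"
      using ranked_eigenvector_equation[OF A pq tri res] .
    also have "\<dots> = (P * D) $$ (p, q)"
      unfolding D_def mat_diag_mult_right[OF P] using pq by (simp add: P_def mult.commute)
    finally show "(A * P) $$ (p, q) = (P * D) $$ (p, q)" .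
  qed (use A P D in auto)
  have "z = 0\<^sub>v n" if z: "z \<in> carrier_vec n" and Pz: "P *\<^sub>v z = 0\<^sub>v n" for z
  proof -
    have "z $ q = 0" if "q < n" for q
      using that
    proof (induction "h q" arbitrary: q rule: less_induct)
      case less
      have "0 = (P *\<^sub>v z) $ q"
        using Pz less.prems by simp
      also have "\<dots> = (\<Sum>r<n. ranked_eigenvector A h r q * z $ r)"
        using P z less.prems
        by (auto simp: P_def scalar_prod_def atLeast0LessThan intro!: sum.cong)
      \<comment> \<open>\<open>P\<close> is unitriangular with respect to \<open>h\<close>: for
        smaller rank \<open>z $ r\<close> is 0 by induction, and for the other \<open>r\<close>
        different from \<open>q\<close> the coefficient is 0.\<close>
      also have "\<dots> = (\<Sum>r<n. if r = q then z $ q else 0)"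
      proof (rule sum.cong[OF refl])
        fix r
        assume "r \<in> {..<n}"
        then show "ranked_eigenvector A h r q * z $ r = (if r = q then z $ q else 0)"
          using less.hyps[of r] ranked_eigenvector_eq_0[of q r h A]
          by (cases "h q \<le> h r") (auto simp: ranked_eigenvector_self)
      qed
      also have "\<dots> = z $ q"
        using less.prems by simp
      finally show ?case
        by simp
    qed
    then show ?thesis
      using z by (intro eq_vecI) auto
  qed
  then have "similar_mat A D"
    by (rule similar_mat_if_eigenbasis[OF A D P AP])
  moreover have "diagonal_mat D"
    by (auto simp: D_def mat_diag_def diagonal_mat_def)
  ultimately show ?thesis
    unfolding diagonalizable_def by blast
qed

section \<open>The traffic system matrix\<close>

text \<open>All block cases merge into one formula: velocities fill the whole diagonal, class
  matrices only the last block column.\<close>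

lemma system_matrix_index:
  assumes "p < N * (M + 1)" and "q < N * (M + 1)"
  shows "system_matrix N M v U $$ (p, q) =
    (if q div (M + 1) + 1 = N
     then class_matrix N M v U (p div (M + 1) + 1) $$ (p mod (M + 1), q mod (M + 1)) else 0)
    + (if p = q then v (p mod (M + 1)) else 0)"
proof -
  have eq_iff: "p = q \<longleftrightarrow> p div (M + 1) = q div (M + 1) \<and> p mod (M + 1) = q mod (M + 1)"
    by (metis div_mult_mod_eq)
  have "p mod (M + 1) < M + 1" and "q mod (M + 1) < M + 1"
    by simp_all
  then show ?thesis
    using assms unfolding eq_iff
    by (auto simp: system_matrix_def system_block_def velocity_matrix_def mat_diag_def
        class_matrix_def)
qed

lemma cumul_bounds:
  assumes U: "U \<in> physical_domain N M" and "1 \<le> c" and "c \<le> N" and i: "i \<le> M"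
  shows "0 \<le> cumul M U c i" and "cumul M U c i \<le> cumul M U N i"
proof -
  have mono_Suc: "cumul M U d i \<le> cumul M U (Suc d) i" if "1 \<le> d" and "d < N" for d
    using U i that by (auto simp: physical_domain_def)
  have mono: "cumul M U d i \<le> cumul M U e i" if "1 \<le> d" and "d \<le> e" and "e \<le> N" for d e
    using \<open>d \<le> e\<close> \<open>e \<le> N\<close>
  proof (induction e rule: dec_induct)
    case (step e)
    then show ?case
      using \<open>1 \<le> d\<close> mono_Suc[of e]
      by simp
  qed simp
  have "0 \<le> cumul M U 1 i"
    using U i by (auto simp: physical_domain_def)
  then show "0 \<le> cumul M U c i"
    using mono[of 1 c] assms by simp
  show "cumul M U c i \<le> cumul M U N i"
    using mono[of c N] assms by simp
qed

lemma diagonalizable_system_matrix: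
  assumes mono: "\<And>i j. i < j \<Longrightarrow> j \<le> M \<Longrightarrow> v i < v j"
    and U: "U \<in> physical_domain N M"
  shows "diagonalizable (system_matrix N M v U)"
proof -
  define m where "m = M + 1"
  define n where "n = N * m"
  \<comment> \<open>For positive \<open>N\<close>, the last block starts at index
    \<open>K\<close>.\<close>
  define K where "K = (N - 1) * m"
  define A where "A = system_matrix N M v U"
  define B where "B = class_matrix N M v U"
  define s where "s = 1 / (1 - total_density N M U)"
  define S where "S c i = s * (\<Sum>l=i+1..M. (v l - v i) * cumul M U c l)" for c i
  have m: "0 < m"
    by (simp add: m_def)
  \<comment> \<open>At total density 1 the default \<open>1 / 0 = 0\<close> gives
    \<open>s = 0\<close>, so this case is covered as well.\<close>
  have s: "0 \<le> s"
    using U by (simp add: s_def physical_domain_def)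
  have B_diag: "B c $$ (i, i) = - S c i" if "i < m" for c i
    using that by (simp add: B_def class_matrix_def S_def s_def m_def)
  have B_upper: "B c $$ (i, j) = 0" if "i < j" and "j < m" for c i j
    using that by (simp add: B_def class_matrix_def m_def)
  have entry: "A $$ (p, q) = (if q div m + 1 = N then B (p div m + 1) $$ (p mod m, q mod m) else 0)
    + (if p = q then v (p mod m) else 0)" if "p < n" and "q < n" for p q
    using that system_matrix_index unfolding A_def B_def m_def n_def by simp
  have block_less: "p div m < N" if "p < n" for p
    using that m by (simp add: n_def less_mult_imp_div_less)
  have last: "p div m + 1 = N \<longleftrightarrow> K \<le> p" if "p < n" for p
    using block_less[OF that] m less_eq_div_iff_mult_less_eq[OF m, of "N - 1" p]
    unfolding K_def by linarith
  have mod_last: "p mod m = p - K" if "p < n" and "K \<le> p" for p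
    using last[OF that(1)] that
    by (simp add: K_def modulo_nat_def mult.commute flip: Suc_eq_plus1) auto
  have v_mono: "v i \<le> v j" if "i \<le> j" and "j < m" for i j
    using that mono[of i j] by (cases "i = j") (auto simp: m_def)
  have S_nonneg: "0 \<le> S c i" and S_le: "S c i \<le> S N i" if "1 \<le> c" "c \<le> N" for c i
    using that s cumul_bounds[OF U that] v_mono
    by (auto simp: S_def m_def intro!: mult_nonneg_nonneg sum_nonneg mult_left_mono sum_mono)
  \<comment> \<open>Passing from \<open>j\<close> down to \<open>i\<close> enlarges every weight and
    adds nonnegative terms, so \<open>S N\<close> is nonincreasing and the strict growth of
    \<open>v\<close> survives.\<close>
  have eig_less: "v i - S N i < v j - S N j" if "i < j" "j < m" "1 \<le> N" for i j
  proof -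
    have "(\<Sum>l=j+1..M. (v l - v j) * cumul M U N l) \<le> (\<Sum>l=j+1..M. (v l - v i) * cumul M U N l)"
      using that cumul_bounds[OF U, of N] v_mono[of i j] by (intro sum_mono mult_right_mono) auto
    also have "\<dots> \<le> (\<Sum>l=i+1..M. (v l - v i) * cumul M U N l)"
      using that cumul_bounds[OF U, of N] v_mono
      by (intro sum_mono2 mult_nonneg_nonneg) (auto simp: m_def)
    finally have "S N j \<le> S N i"
      using s by (simp add: S_def mult_left_mono)
    then show ?thesis
      using mono[of i j] that by (simp add: m_def)
  qed
  \<comment> \<open>The last block is moved to the front, which makes \<open>A\<close> lower triangular.\<close>
  define h where "h p = (if K \<le> p then p else p + n)" for p
  have "diagonalizable A"
  proof (rule diagonalizable_if_ranked_triangular[of A n h])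
    show "A \<in> carrier_mat n n"
      by (simp add: A_def system_matrix_def n_def m_def)
    show "A $$ (p, q) = 0" if p: "p < n" and q: "q < n" and "p \<noteq> q" and "h p \<le> h q" for p q
    proof (cases "K \<le> q")
      case True
      then have "K \<le> p" and "p < q"
        using that by (auto simp: h_def split: if_splits)
      then have "p mod m < q mod m"
        using mod_last p q True by simp
      then show ?thesis
        using entry[OF p q] \<open>p \<noteq> q\<close> B_upper m by simp
    next
      case False
      then show ?thesis
        using entry[OF p q] \<open>p \<noteq> q\<close> last[OF q] by simp
    qed
    show "A $$ (p, r) = 0"
      if p: "p < n" and q: "q < n" and r: "r < n" and eq: "A $$ (p, p) = A $$ (q, q)"
        and hqr: "h q \<le> h r" and hrp: "h r < h p" for p q r
    proof (cases "K \<le> r")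
      case False
      then show ?thesis
        using entry[OF p r] last[OF r] hrp by auto
    next
      case True
      \<comment> \<open>Ranks outside the last block are at least \<open>n\<close>, whereas
        \<open>h r = r < n\<close>.\<close>
      then have Kq: "K \<le> q" and "q \<le> r"
        using hqr r by (auto simp: h_def split: if_splits)
      have le: "q mod m \<le> r mod m"
        using mod_last q r Kq True \<open>q \<le> r\<close> by simp
      have N: "1 \<le> N" "q div m + 1 = N" "r div m + 1 = N"
        using last[OF q] last[OF r] Kq True by auto
      have Aqq: "A $$ (q, q) = v (q mod m) - S N (q mod m)"
        using entry[OF q q] N B_diag m by simp
      \<comment> \<open>Within the last block the diagonal entries are pairwise distinct by
        \<open>eig_less\<close>.\<close>
      have "\<not> K \<le> p"
      proof
        assume Kp: "K \<le> p"
        then have "q < p"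
          using hrp \<open>q \<le> r\<close> True by (simp add: h_def)
        then have "q mod m < p mod m"
          using mod_last p q Kp Kq by simp
        moreover have "A $$ (p, p) = v (p mod m) - S N (p mod m)"
          using entry[OF p p] last[OF p] Kp B_diag m by simp
        ultimately show False
          using eig_less[of "q mod m" "p mod m"] Aqq eq N m by simp
      qed
      then have "A $$ (p, p) = v (p mod m)"
        using entry[OF p p] last[OF p] by simp
      then have v_eq: "v (p mod m) = v (q mod m) - S N (q mod m)"
        using Aqq eq by simp
      have "p mod m \<le> q mod m"
      proof (rule ccontr)
        assume "\<not> p mod m \<le> q mod m"
        then have "v (q mod m) < v (p mod m)"
          using mono m pos_mod_bound by (simp add: m_def less_Suc_eq_le[symmetric])
        then show False
          using v_eq S_nonneg[of N "q mod m"] N by simp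
      qed
      have Apr: "A $$ (p, r) = B (p div m + 1) $$ (p mod m, r mod m)"
        using entry[OF p r] N hrp by auto
      show ?thesis
      proof (cases "p mod m < r mod m")
        case True
        then show ?thesis
          using Apr B_upper m by simp
      next
        \<comment> \<open>All three positions within the blocks coincide here, so the entry in
          question is a diagonal entry of a class matrix, squeezed to 0 by \<open>S_nonneg\<close>
          and \<open>S_le\<close>.\<close>
        case False
        then have "p mod m = q mod m" and pr: "r mod m = p mod m"
          using le \<open>p mod m \<le> q mod m\<close> by auto
        then have "S N (p mod m) = 0"
          using v_eq by simp
        then have "S (p div m + 1) (p mod m) = 0"
          using S_nonneg[of "p div m + 1" "p mod m"] S_le[of "p div m + 1" "p mod m"]
            block_less[OF p] by simp
        then show ?thesis
          using Apr pr B_diag m by simp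
      qed
    qed
  qed
  then show ?thesis
    by (simp add: A_def)
qed

theorem proposition3p2:
  fixes N M :: nat and v :: "nat \<Rightarrow> real" and \<epsilon> :: real and T :: "nat \<Rightarrow> real"
    and fe :: "nat \<Rightarrow> nat \<Rightarrow> real vec \<Rightarrow> real" and U :: "real vec"
  assumes "N \<ge> 1" and "M \<ge> 1"
    and "v 0 = 0" and "v M = 1" and "\<forall>i<M. v i < v (i + 1)"
    and "\<epsilon> > 0" and "\<forall>k\<in>{1..N}. T k > 0"
    and "\<forall>W\<in>physical_domain N M. \<forall>k\<in>{1..N}.
           (\<Sum>i=0..M. fe k i (density_vec N M W)) = class_density M W k"
    and "U \<in> physical_domain N M"
  shows "diagonalizable (system_matrix N M v U) \<and>
         hyperbolic_at (traffic_system N M v \<epsilon> T fe) U"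
proof -
  have "v i < v j" if "i < j" and "j \<le> M" for i j
    using that
  proof (induction j)
    case (Suc j)
    then show ?case
      using assms(5) by (cases "i = j") (auto intro: less_trans)
  qed simp
  then have "diagonalizable (system_matrix N M v U)"
    using diagonalizable_system_matrix assms(9) by blast
  then show ?thesis
    using diagonalizable_imp_real_eigenvalues diagonalizable_imp_complete_eigenvectors
    by (simp add: hyperbolic_at_def traffic_system_def system_matrix_def)
qed

end
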